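(* Let $(Y,\rho,\upsilon)$ be an indecomposable solution of multipermutation level $2$. Then the automorphism group $\mathrm{Aut}(Y)$ is regular, i.e. it acts regularly on $Y$.
   Context: A solution (set-theoretic, non-degenerate, involutive solution of the Yang-Baxter equation) is a triple $(X,\sigma,\tau)$ with $X$ a non-empty set and $\sigma,\tau\colon X^2\to X$ such that, writing $\sigma_x=\sigma(x,\cdot)$ and $\tau_y=\tau(\cdot,y)$, the map $r(x,y)=(\sigma_x(y),\tau_y(x))$ is a bijection of $X^2$ satisfying $(\mathrm{id}\times r)(r\times \mathrm{id})(\mathrm{id}\times r)=(r\times \mathrm{id})(\mathrm{id}\times r)(r\times \mathrm{id})$, all $\sigma_x,\tau_y$ are bijections, and $r^2=\mathrm{id}$. It is indecomposable if $\mathcal{G}(X)=\langle\sigma_x\mid x\in X\rangle$ acts transitively on $X$. Put $x\sim y$ iff $\tau_x=\tau_y$. The quotient $X/{\sim}$ carries an induced solution, the retraction $\mathrm{Ret}(X)$. The solution has multipermutation level $2$ if $|\mathrm{Ret}(X)|>1$ and $|\mathrm{Ret}(\mathrm{Ret}(X))|=1$. A homomorphism from $(X,\sigma,\tau)$ to $(X',\sigma',\tau')$ is a map $\Phi\colon X\to X'$ with $\Phi\sigma_x=\sigma'_{\Phi(x)}\Phi$ for all $x\in X$; automorphisms are bijective homomorphisms of a solution to itself. *)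

theory Defs
  imports "HOL-Algebra.Group_Action" "HOL-Algebra.Generated_Groups"
begin

text \<open>
  Both operations take their arguments in the order of the underlying set \<open>X \<times> X\<close>, so that
  \<open>\<sigma>\<^sub>x\<close> is \<open>sigma S x\<close>, while \<open>\<tau>\<^sub>y\<close> is \<open>\<lambda>x. tau S x y\<close>.
\<close>

record 'a ybe = "'a partial_object" +
  sigma :: "'a \<Rightarrow> 'a \<Rightarrow> 'a"
  tau :: "'a \<Rightarrow> 'a \<Rightarrow> 'a"

definition ybe_map :: "('a, 'b) ybe_scheme \<Rightarrow> 'a \<times> 'a \<Rightarrow> 'a \<times> 'a"
  where "ybe_map S = (\<lambda>(x, y). (sigma S x y, tau S x y))"

definition times_id :: "('a \<times> 'a \<Rightarrow> 'a \<times> 'a) \<Rightarrow> 'a \<times> 'a \<times> 'a \<Rightarrow> 'a \<times> 'a \<times> 'a"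
  where "times_id r = (\<lambda>(x, y, z). case r (x, y) of (u, v) \<Rightarrow> (u, v, z))"

definition id_times :: "('a \<times> 'a \<Rightarrow> 'a \<times> 'a) \<Rightarrow> 'a \<times> 'a \<times> 'a \<Rightarrow> 'a \<times> 'a \<times> 'a"
  where "id_times r = (\<lambda>(x, y, z). case r (y, z) of (v, w) \<Rightarrow> (x, v, w))"

locale ybe_solution =
  fixes S :: "('a, 'b) ybe_scheme" (structure)
  assumes nonempty: "carrier S \<noteq> {}"
    and bij_map: "bij_betw (ybe_map S) (carrier S \<times> carrier S) (carrier S \<times> carrier S)"
    and yang_baxter: "\<And>t. t \<in> carrier S \<times> carrier S \<times> carrier S \<Longrightarrow>
      (id_times (ybe_map S) \<circ> times_id (ybe_map S) \<circ> id_times (ybe_map S)) t =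
      (times_id (ybe_map S) \<circ> id_times (ybe_map S) \<circ> times_id (ybe_map S)) t"
    and bij_sigma: "\<And>x. x \<in> carrier S \<Longrightarrow> bij_betw (sigma S x) (carrier S) (carrier S)"
    and bij_tau: "\<And>y. y \<in> carrier S \<Longrightarrow> bij_betw (\<lambda>x. tau S x y) (carrier S) (carrier S)"
    and involutive: "\<And>p. p \<in> carrier S \<times> carrier S \<Longrightarrow> ybe_map S (ybe_map S p) = p"

definition perm_group :: "('a, 'b) ybe_scheme \<Rightarrow> ('a \<Rightarrow> 'a) monoid"
  where "perm_group S = BijGroup (carrier S)
    \<lparr>carrier := generate (BijGroup (carrier S))
       {restrict (sigma S x) (carrier S) | x. x \<in> carrier S}\<rparr>"

definition indecomposable :: "('a, 'b) ybe_scheme \<Rightarrow> bool"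
  where "indecomposable S \<longleftrightarrow> transitive_action (perm_group S) (carrier S) (\<lambda>g. g)"

definition ret_rel :: "('a, 'b) ybe_scheme \<Rightarrow> ('a \<times> 'a) set"
  where "ret_rel S = {(x, y). x \<in> carrier S \<and> y \<in> carrier S \<and>
    (\<forall>z\<in>carrier S. tau S z x = tau S z y)}"

text \<open>
  The operations on \<open>X/\<sim>\<close> are \<open>\<sigma>([x], [y]) = [\<sigma>(x, y)]\<close> and \<open>\<tau>([x], [y]) = [\<tau>(x, y)]\<close>. They
  are written in the style of \<open>UN_equiv_class2\<close>: as the result does not depend on the chosen
  representatives when \<open>S\<close> is a solution, the unions range over copies of one and the same class.
\<close>

definition Ret :: "('a, 'b) ybe_scheme \<Rightarrow> 'a set ybe"
  where "Ret S =
    \<lparr>carrier = carrier S // ret_rel S,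
     sigma = \<lambda>A B. \<Union>x\<in>A. \<Union>y\<in>B. ret_rel S `` {sigma S x y},
     tau = \<lambda>A B. \<Union>x\<in>A. \<Union>y\<in>B. ret_rel S `` {tau S x y}\<rparr>"

text \<open>
  The carrier may be infinite, and \<open>card\<close> is \<open>0\<close> on infinite sets, so \<open>|Ret(X)| > 1\<close> is
  stated without \<open>card\<close>.
\<close>

definition multipermutation_level_2 :: "('a, 'b) ybe_scheme \<Rightarrow> bool"
  where "multipermutation_level_2 S \<longleftrightarrow>
    (\<exists>A\<in>carrier (Ret S). \<exists>B\<in>carrier (Ret S). A \<noteq> B) \<and>
    card (carrier (Ret (Ret S))) = 1"

definition ybe_hom :: "('a, 'b) ybe_scheme \<Rightarrow> ('c, 'd) ybe_scheme \<Rightarrow> ('a \<Rightarrow> 'c) set"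
  where "ybe_hom S T = {\<Phi> \<in> carrier S \<rightarrow> carrier T.
    \<forall>x\<in>carrier S. \<forall>y\<in>carrier S. \<Phi> (sigma S x y) = sigma T (\<Phi> x) (\<Phi> y)}"

definition ybe_Aut :: "('a, 'b) ybe_scheme \<Rightarrow> ('a \<Rightarrow> 'a) monoid"
  where "ybe_Aut S = BijGroup (carrier S)
    \<lparr>carrier := ybe_hom S S \<inter> Bij (carrier S)\<rparr>"

locale regular_action = transitive_action +
  assumes free: "\<lbrakk> x \<in> E; g \<in> carrier G; (\<phi> g) x = x \<rbrakk> \<Longrightarrow> g = \<one>"

end

theory Submission
  imports Defs
begin

text \<open>
  In a solution of multipermutation level 2 the class of \<open>\<sigma>\<^sub>x(z)\<close> in the retraction does not depend
  on \<open>x\<close>; call it \<open>f[z]\<close>. If a self-map \<open>p\<close> of \<open>X\<close> induces a map of the retraction commuting with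
  \<open>f\<close>, then \<open>z \<mapsto> \<sigma>\<^bsub>p(z)\<^esub>(z)\<close> is an automorphism. Indecomposability provides such a \<open>p\<close> with a
  prescribed value at a prescribed point, so that every \<open>\<sigma>\<^sub>a(x)\<close> lies in the \<open>Aut\<close>-orbit of \<open>x\<close>, and
  the action is transitive. An automorphism fixing a point induces the identity on the retraction,
  hence commutes with every \<open>\<sigma>\<^sub>x\<close> and is the identity.
\<close>

section \<open>The retraction relation expressed through \<open>sigma\<close>\<close>

text \<open>Counterpart in \<open>sigma\<close> of the \<open>tau\<close>-based
  \<open>ret_rel\<close>, suited to homomorphisms and \<open>perm_group\<close>, which are defined
  by \<open>sigma\<close> alone.\<close>

definition same_sigma :: "('a, 'b) ybe_scheme \<Rightarrow> 'a \<Rightarrow> 'a \<Rightarrow> bool"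
  where "same_sigma S x y \<longleftrightarrow> (\<forall>z\<in>carrier S. sigma S x z = sigma S y z)"

lemma same_sigma_refl: "same_sigma S x x"
  by (simp add: same_sigma_def)

lemma same_sigma_sym: "same_sigma S x y \<Longrightarrow> same_sigma S y x"
  by (simp add: same_sigma_def)

lemma same_sigma_trans [trans]:
  "same_sigma S x y \<Longrightarrow> same_sigma S y z \<Longrightarrow> same_sigma S x z"
  by (simp add: same_sigma_def)

lemma same_sigmaD: "same_sigma S x y \<Longrightarrow> z \<in> carrier S \<Longrightarrow> sigma S x z = sigma S y z"
  by (simp add: same_sigma_def)

context ybe_solution
begin

lemma sigma_closed [simp]: "x \<in> carrier S \<Longrightarrow> y \<in> carrier S \<Longrightarrow> sigma S x y \<in> carrier S"
  using bij_sigma bij_betwE by blast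

lemma tau_closed [simp]: "x \<in> carrier S \<Longrightarrow> y \<in> carrier S \<Longrightarrow> tau S x y \<in> carrier S"
  using bij_tau bij_betwE by blast

lemma sigma_inj:
  assumes "x \<in> carrier S" "y \<in> carrier S" "z \<in> carrier S" "sigma S x y = sigma S x z"
  shows "y = z"
  using bij_sigma[OF assms(1)] assms(2-4) by (auto simp: bij_betw_def inj_on_def)

lemma tau_inj:
  assumes "x \<in> carrier S" "y \<in> carrier S" "z \<in> carrier S" "tau S y x = tau S z x"
  shows "y = z"
  using bij_tau[OF assms(1)] assms(2-4) by (auto simp: bij_betw_def inj_on_def)

lemma sigma_surj:
  assumes "x \<in> carrier S" "z \<in> carrier S"
  obtains y where "y \<in> carrier S" "sigma S x y = z"
proof -
  have "z \<in> sigma S x ` carrier S"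
    using bij_betw_imp_surj_on[OF bij_sigma[OF assms(1)]] assms(2) by simp
  then show ?thesis using that by auto
qed

lemma tau_surj:
  assumes "x \<in> carrier S" "z \<in> carrier S"
  obtains y where "y \<in> carrier S" "tau S y x = z"
proof -
  have "z \<in> (\<lambda>y. tau S y x) ` carrier S"
    using bij_betw_imp_surj_on[OF bij_tau[OF assms(1)]] assms(2) by simp
  then show ?thesis using that by auto
qed

lemma involutive_sigma:
  "x \<in> carrier S \<Longrightarrow> y \<in> carrier S \<Longrightarrow> sigma S (sigma S x y) (tau S x y) = x"
  and involutive_tau:
  "x \<in> carrier S \<Longrightarrow> y \<in> carrier S \<Longrightarrow> tau S (sigma S x y) (tau S x y) = y"
  using involutive[of "(x, y)"] by (auto simp: ybe_map_def)

text \<open>First component of the Yang-Baxter equation at \<open>(x, y, z)\<close>.\<close>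

lemma sigma_sigma:
  assumes "x \<in> carrier S" "y \<in> carrier S" "z \<in> carrier S"
  shows "sigma S x (sigma S y z) = sigma S (sigma S x y) (sigma S (tau S x y) z)"
  using yang_baxter[of "(x, y, z)"] assms
  by (auto simp: ybe_map_def times_id_def id_times_def)

text \<open>
  The relation \<open>\<sigma>\<^sub>x(t) = x\<close> is the graph of the bijection \<open>T(x) = \<sigma>\<^sub>x\<inverse>(x)\<close>, whose inverse is
  \<open>t \<mapsto> \<tau>\<^sub>t\<inverse>(t)\<close>; it intertwines \<open>\<tau>\<^sub>w\<close> and \<open>\<sigma>\<^sub>w\<inverse>\<close>.
\<close>

lemma sigma_fix_iff_tau_fix:
  assumes "x \<in> carrier S" "t \<in> carrier S"
  shows "sigma S x t = x \<longleftrightarrow> tau S x t = t"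
proof
  assume "sigma S x t = x"
  with involutive_sigma[OF assms] show "tau S x t = t"
    using assms by - (rule sigma_inj[of x], simp_all)
next
  assume "tau S x t = t"
  with involutive_tau[OF assms] show "sigma S x t = x"
    using assms by - (rule tau_inj[of t], simp_all)
qed

lemma sigma_fix_tau:
  assumes "w \<in> carrier S" "y \<in> carrier S" "u \<in> carrier S" "sigma S y (sigma S w u) = y"
  shows "sigma S (tau S y w) u = tau S y w"
proof (rule sigma_inj)
  \<comment> \<open>Both sides equal \<open>y\<close>: the left by \<open>sigma_sigma\<close>, the
    right by involutivity.\<close>
  show "sigma S (sigma S y w) (sigma S (tau S y w) u) = sigma S (sigma S y w) (tau S y w)"
    using assms sigma_sigma[of y w u] involutive_sigma[of y w] by simp
qed (use assms in simp_all)

text \<open>Conjugation by the bijection T turns each \<open>tau\<close> map into the inverse of the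
  corresponding \<open>sigma\<close> map, so equality in one family is equality in the
  other.\<close>

lemma same_sigma_iff_tau:
  assumes w: "w \<in> carrier S" and z: "z \<in> carrier S"
  shows "same_sigma S w z \<longleftrightarrow> (\<forall>y\<in>carrier S. tau S y w = tau S y z)"
proof (intro iffI ballI)
  fix y assume E: "same_sigma S w z" and y: "y \<in> carrier S"
  \<comment> \<open>Here \<open>t\<close> is T(y) and \<open>u\<close> is T of
    \<open>tau S y w\<close>. The same \<open>u\<close> serves for \<open>z\<close>, and T is
    injective.\<close>
  obtain t where t: "t \<in> carrier S" "sigma S y t = y"
    using sigma_surj y by blast
  obtain u where u: "u \<in> carrier S" "sigma S w u = t"
    using sigma_surj w t by blast
  have "sigma S z u = t"
    using E u by (simp add: same_sigma_def)
  then have "sigma S (tau S y w) u = tau S y w" "sigma S (tau S y z) u = tau S y z"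
    using sigma_fix_tau w z y u t by auto
  then show "tau S y w = tau S y z"
    using sigma_fix_iff_tau_fix tau_inj[OF u(1)] w z y u(1) by (metis tau_closed)
next
  assume E: "\<forall>y\<in>carrier S. tau S y w = tau S y z"
  have "sigma S w u = sigma S z u" if u: "u \<in> carrier S" for u
  proof -
    \<comment> \<open>\<open>y\<close> and \<open>y'\<close> are the preimages under T of the two
      values to be compared, so it suffices to show \<open>y = y'\<close>.\<close>
    obtain y where y: "y \<in> carrier S" "tau S y (sigma S w u) = sigma S w u"
      using tau_surj[of "sigma S w u" "sigma S w u"] w u by auto
    obtain y' where y': "y' \<in> carrier S" "tau S y' (sigma S z u) = sigma S z u"
      using tau_surj[of "sigma S z u" "sigma S z u"] z u by auto
    have s: "sigma S y (sigma S w u) = y" "sigma S y' (sigma S z u) = y'"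
      using y y' w z u by (simp_all add: sigma_fix_iff_tau_fix)
    then have "sigma S (tau S y w) u = tau S y w" "sigma S (tau S y' z) u = tau S y' z"
      using sigma_fix_tau w z y y' u by auto
    then have "tau S y w = tau S y' z"
      using sigma_fix_iff_tau_fix tau_inj[OF u] w z y(1) y'(1) u by (metis tau_closed)
    then have "y = y'"
      using E y(1) y'(1) w z tau_inj by metis
    with s show ?thesis
      using sigma_inj[OF y(1)] w z u by (metis sigma_closed)
  qed
  then show "same_sigma S w z"
    by (simp add: same_sigma_def)
qed

lemma ret_rel_iff:
  "(x, y) \<in> ret_rel S \<longleftrightarrow> x \<in> carrier S \<and> y \<in> carrier S \<and> same_sigma S x y"
  unfolding ret_rel_def using same_sigma_iff_tau by blast

lemma equiv_ret_rel: "equiv (carrier S) (ret_rel S)"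
  by (intro equivI refl_onI symI transI)
    (auto simp: ret_rel_iff intro: same_sigma_refl same_sigma_sym same_sigma_trans)

section \<open>Operations on retraction classes\<close>

text \<open>Either side forces \<open>tau S x y = tau S x z\<close>. Then \<open>sigma_sigma\<close>
  factors both composites with the same inner bijection, which cancels.\<close>

lemma same_sigma_sigma_iff:
  assumes "x \<in> carrier S" "y \<in> carrier S" "z \<in> carrier S"
  shows "same_sigma S (sigma S x y) (sigma S x z) \<longleftrightarrow> same_sigma S y z"
proof
  assume E: "same_sigma S (sigma S x y) (sigma S x z)"
  have "tau S x y = tau S x z"
    using assms involutive_sigma[of x y] involutive_sigma[of x z] same_sigmaD[OF E]
    by - (rule sigma_inj[of "sigma S x z"], simp_all)
  then have "sigma S x (sigma S y u) = sigma S x (sigma S z u)" if "u \<in> carrier S" for u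
    using assms that same_sigmaD[OF E] sigma_sigma[of x y u] sigma_sigma[of x z u] by simp
  then show "same_sigma S y z"
    unfolding same_sigma_def using assms sigma_inj by (metis sigma_closed)
next
  assume E: "same_sigma S y z"
  then have t: "tau S x y = tau S x z"
    using same_sigma_iff_tau assms by blast
  show "same_sigma S (sigma S x y) (sigma S x z)"
    unfolding same_sigma_def
  proof
    fix u assume u: "u \<in> carrier S"
    obtain v where v: "v \<in> carrier S" "sigma S (tau S x y) v = u"
      using sigma_surj[of "tau S x y" u] assms u by auto
    have "sigma S x (sigma S y v) = sigma S x (sigma S z v)"
      using same_sigmaD[OF E] v by simp
    then show "sigma S (sigma S x y) u = sigma S (sigma S x z) u"
      using v t assms sigma_sigma[of x y v] sigma_sigma[of x z v] by simp
  qed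
qed

text \<open>In \<open>sigma_sigma\<close> for \<open>y, x\<close> and for \<open>z, x\<close> the
  outer factors agree and cancel.\<close>

lemma same_sigma_tau:
  assumes "x \<in> carrier S" "y \<in> carrier S" "z \<in> carrier S" and E: "same_sigma S y z"
  shows "same_sigma S (tau S y x) (tau S z x)"
proof -
  have "sigma S (tau S y x) u = sigma S (tau S z x) u" if "u \<in> carrier S" for u
    using sigma_sigma[of y x u] sigma_sigma[of z x u] assms(1-3) that same_sigmaD[OF E]
    by - (rule sigma_inj[of "sigma S y x"], simp_all)
  then show ?thesis
    by (simp add: same_sigma_def)
qed

text \<open>Independence of representatives: in the right argument it is the definition of
  \<open>ret_rel\<close>, in the left it is \<open>same_sigma_tau\<close>.\<close>

lemma tau_Ret_class:
  assumes "x \<in> carrier S" "y \<in> carrier S"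
  shows "tau (Ret S) (ret_rel S `` {x}) (ret_rel S `` {y}) = ret_rel S `` {tau S x y}"
proof -
  have "congruent2 (ret_rel S) (ret_rel S) (\<lambda>x y. ret_rel S `` {tau S x y})"
  proof (rule congruent2I')
    fix a a' b b' assume a: "(a, a') \<in> ret_rel S" and b: "(b, b') \<in> ret_rel S"
    have "tau S a b = tau S a b'"
      using a b by (simp add: ret_rel_def)
    moreover have "same_sigma S (tau S a b') (tau S a' b')"
      using same_sigma_tau[of b' a a'] a b by (simp add: ret_rel_iff)
    ultimately have "(tau S a b, tau S a' b') \<in> ret_rel S"
      using a b by (simp add: ret_rel_iff)
    then show "ret_rel S `` {tau S a b} = ret_rel S `` {tau S a' b'}"
      by (rule equiv_class_eq[OF equiv_ret_rel])
  qed
  then show ?thesis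
    using UN_equiv_class2[OF equiv_ret_rel equiv_ret_rel _ assms] by (simp add: Ret_def)
qed

section \<open>Induction along the permutation group\<close>

lemma Bij_sigma: "x \<in> carrier S \<Longrightarrow> restrict (sigma S x) (carrier S) \<in> Bij (carrier S)"
  using bij_sigma by (simp add: Bij_def)

text \<open>Invariance of \<open>P\<close> passes from the generators to the whole group, and
  transitivity spreads it from \<open>x\<close>. The step is an equivalence so that it also covers
  inverses of generators.\<close>

lemma indecomposable_induct:
  assumes ind: "indecomposable S" and x: "x \<in> carrier S" "P x"
    and step: "\<And>a z. a \<in> carrier S \<Longrightarrow> z \<in> carrier S \<Longrightarrow> P (sigma S a z) \<longleftrightarrow> P z"
    and y: "y \<in> carrier S"
  shows "P y"
proof -
  let ?B = "BijGroup (carrier S)"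
  let ?H = "{restrict (sigma S x) (carrier S) | x. x \<in> carrier S}"
  interpret group ?B by (rule group_BijGroup)
  have H: "?H \<subseteq> carrier ?B"
    using Bij_sigma by (auto simp: BijGroup_def)
  have inv: "\<forall>z\<in>carrier S. P (g z) \<longleftrightarrow> P z" if "g \<in> generate ?B ?H" for g
    using that
  proof induction
    case one
    then show ?case by (simp add: BijGroup_def)
  next
    case (incl h)
    then show ?case using step by auto
  next
    case (inv h)
    then obtain a where a: "a \<in> carrier S" "h = restrict (sigma S a) (carrier S)" by blast
    have h: "h \<in> Bij (carrier S)" using a Bij_sigma by simp
    show ?case
    proof
      fix z assume z: "z \<in> carrier S"
      let ?w = "inv_into (carrier S) h z"
      have w: "?w \<in> carrier S" "h ?w = z"
        using h z by (auto simp: Bij_inv_into_mem) (auto simp: Bij_def bij_betw_def f_inv_into_f)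
      then have "P ?w \<longleftrightarrow> P z"
        using a step by (metis restrict_apply)
      then show "P ((inv\<^bsub>?B\<^esub> h) z) \<longleftrightarrow> P z"
        using inv_BijGroup[OF h] z by simp
    qed
  next
    case (eng h1 h2)
    have h: "h1 \<in> Bij (carrier S)" "h2 \<in> Bij (carrier S)"
      using generate_in_carrier[OF H eng.hyps(1)] generate_in_carrier[OF H eng.hyps(2)]
      by (simp_all add: BijGroup_def)
    show ?case
      using h eng.IH funcset_mem[OF Bij_imp_funcset[OF h(2)]]
      by (simp add: BijGroup_def compose_eq)
  qed
  have "\<exists>g\<in>carrier (perm_group S). g x = y"
    using ind x y transitive_action.unique_orbit unfolding indecomposable_def by fastforce
  then obtain g where "g \<in> generate ?B ?H" "g x = y"
    by (auto simp: perm_group_def)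
  with inv x show ?thesis by blast
qed

section \<open>The automorphism group and its action\<close>

lemma ybe_Aut_iff:
  "\<Phi> \<in> carrier (ybe_Aut S) \<longleftrightarrow> \<Phi> \<in> Bij (carrier S) \<and>
    (\<forall>x\<in>carrier S. \<forall>y\<in>carrier S. \<Phi> (sigma S x y) = sigma S (\<Phi> x) (\<Phi> y))"
  using Bij_imp_funcset by (auto simp: ybe_Aut_def ybe_hom_def)

lemma ybe_Aut_closed: "\<Phi> \<in> carrier (ybe_Aut S) \<Longrightarrow> x \<in> carrier S \<Longrightarrow> \<Phi> x \<in> carrier S"
  using Bij_imp_funcset by (auto simp: ybe_Aut_iff)

lemma subgroup_ybe_Aut: "subgroup (carrier (ybe_Aut S)) (BijGroup (carrier S))"
proof
  show "carrier (ybe_Aut S) \<subseteq> carrier (BijGroup (carrier S))"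
    by (auto simp: ybe_Aut_iff BijGroup_def)
next
  fix f g assume fg: "f \<in> carrier (ybe_Aut S)" "g \<in> carrier (ybe_Aut S)"
  then show "f \<otimes>\<^bsub>BijGroup (carrier S)\<^esub> g \<in> carrier (ybe_Aut S)"
    using ybe_Aut_closed[OF fg(2)] by (auto simp: ybe_Aut_iff BijGroup_def compose_Bij compose_eq)
next
  show "\<one>\<^bsub>BijGroup (carrier S)\<^esub> \<in> carrier (ybe_Aut S)"
    by (auto simp: ybe_Aut_iff BijGroup_def id_Bij)
next
  fix f assume f: "f \<in> carrier (ybe_Aut S)"
  then have "inv_into (carrier S) f (sigma S x y) =
      sigma S (inv_into (carrier S) f x) (inv_into (carrier S) f y)"
    if "x \<in> carrier S" "y \<in> carrier S" for x y
    using that by (intro Bij_inv_into_lemma[where g = "sigma S"]) (auto simp: ybe_Aut_iff)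
  with f show "inv\<^bsub>BijGroup (carrier S)\<^esub> f \<in> carrier (ybe_Aut S)"
    by (auto simp: ybe_Aut_iff inv_BijGroup restrict_inv_into_Bij Bij_inv_into_mem
        simp del: restrict_apply) (auto simp: Bij_inv_into_mem)
qed

lemma group_action_ybe_Aut: "group_action (ybe_Aut S) (carrier S) (\<lambda>\<Phi>. \<Phi>)"
proof -
  have eq: "ybe_Aut S = BijGroup (carrier S) \<lparr>carrier := carrier (ybe_Aut S)\<rparr>"
    by (simp add: ybe_Aut_def)
  have "group (ybe_Aut S)"
    by (subst eq) (rule subgroup.subgroup_is_group[OF subgroup_ybe_Aut group_BijGroup])
  moreover have "(\<lambda>\<Phi>. \<Phi>) \<in> hom (ybe_Aut S) (BijGroup (carrier S))"
    using subgroup.subset[OF subgroup_ybe_Aut] by (auto simp: hom_def ybe_Aut_def)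
  ultimately show ?thesis
    by (simp add: group_action_def group_hom_def group_hom_axioms_def group_BijGroup)
qed

end

text \<open>
  Equivalent to \<open>|Ret(Ret(X))| = 1\<close>, expressed in \<open>X\<close> itself: all \<open>\<sigma>\<^sub>x\<close> induce the same map of the
  retraction.
\<close>

locale two_permutational = ybe_solution +
  assumes sigma_retract: "\<And>x y z. x \<in> carrier S \<Longrightarrow> y \<in> carrier S \<Longrightarrow> z \<in> carrier S \<Longrightarrow>
    same_sigma S (sigma S x z) (sigma S y z)"

text \<open>A single class in the second retraction makes the class of \<open>tau S w a\<close>
  independent of \<open>a\<close>. Involutivity carries this over to \<open>sigma\<close>: the
  preimage of \<open>w\<close> under \<open>sigma S x\<close> is \<open>tau S w b\<close>, where
  \<open>sigma S w b = x\<close>.\<close>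

lemma (in ybe_solution) two_permutationalI:
  assumes "card (carrier (Ret (Ret S))) = 1"
  shows "two_permutational S"
proof (unfold_locales)
  fix x y z assume [simp]: "x \<in> carrier S" "y \<in> carrier S" "z \<in> carrier S"
  obtain C where C: "carrier (Ret S) // ret_rel (Ret S) = {C}"
    using assms card_1_singletonE by (auto simp: Ret_def[of "Ret S"])
  have rel: "(A, B) \<in> ret_rel (Ret S)" if "A \<in> carrier (Ret S)" "B \<in> carrier (Ret S)" for A B
  proof -
    have "ret_rel (Ret S) `` {A} = ret_rel (Ret S) `` {B}"
      using C quotientI[OF that(1), of "ret_rel (Ret S)"] quotientI[OF that(2), of "ret_rel (Ret S)"]
      by simp
    moreover have "(B, B) \<in> ret_rel (Ret S)"
      using that by (simp add: ret_rel_def)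
    ultimately show ?thesis by blast
  qed
  have tau: "same_sigma S (tau S w a) (tau S w b)"
    if [simp]: "a \<in> carrier S" "b \<in> carrier S" "w \<in> carrier S" for a b w
  proof -
    have cls: "ret_rel S `` {u} \<in> carrier (Ret S)" if "u \<in> carrier S" for u
      using that by (simp add: Ret_def quotientI)
    have "tau (Ret S) (ret_rel S `` {w}) (ret_rel S `` {a}) =
        tau (Ret S) (ret_rel S `` {w}) (ret_rel S `` {b})"
      using rel[OF cls cls, of a b] cls[of w] by (simp add: ret_rel_def)
    then have "ret_rel S `` {tau S w a} = ret_rel S `` {tau S w b}"
      by (simp add: tau_Ret_class)
    then have "(tau S w a, tau S w b) \<in> ret_rel S"
      by (rule eq_equiv_class[OF _ equiv_ret_rel]) simp
    then show ?thesis
      by (simp add: ret_rel_iff)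
  qed
  have tau_sigma: "\<exists>b\<in>carrier S. sigma S w b = c \<and> sigma S c (tau S w b) = w"
    if "w \<in> carrier S" "c \<in> carrier S" for w c
    using that involutive_sigma sigma_surj by metis
  let ?w = "sigma S x z"
  obtain b where b: "b \<in> carrier S" "sigma S x (tau S ?w b) = ?w"
    using tau_sigma[of ?w x] by auto
  obtain c where c: "c \<in> carrier S" "sigma S y (tau S ?w c) = ?w"
    using tau_sigma[of ?w y] by auto
  have "z = tau S ?w b"
    using b by - (rule sigma_inj[of x], simp_all)
  then have "same_sigma S z (tau S ?w c)"
    using tau[of b c ?w] b c by simp
  then have "same_sigma S (sigma S y z) (sigma S y (tau S ?w c))"
    using c(1) by (simp add: same_sigma_sigma_iff)
  then show "same_sigma S (sigma S x z) (sigma S y z)"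
    using c by (auto intro: same_sigma_sym)
qed

context two_permutational
begin

text \<open>The common map f on classes is well defined and injective.\<close>

lemma same_sigma_sigma_sigma_iff:
  assumes "x \<in> carrier S" "y \<in> carrier S" "v \<in> carrier S" "w \<in> carrier S"
  shows "same_sigma S (sigma S x v) (sigma S y w) \<longleftrightarrow> same_sigma S v w"
  using sigma_retract[of x y w] same_sigma_sigma_iff[of x v w] assms
  by (meson same_sigma_sym same_sigma_trans)

section \<open>Maps inducing an endomap of the retraction that commutes with f\<close>

text \<open>Conditions hold only up to \<open>same_sigma\<close>. Independent \<open>x\<close> and
  \<open>y\<close> reflect that f may be computed with any acting element.\<close>

definition compatible :: "('a \<Rightarrow> 'a) \<Rightarrow> bool"
  where "compatible p \<longleftrightarrow> p \<in> carrier S \<rightarrow> carrier S \<and>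
    (\<forall>v\<in>carrier S. \<forall>w\<in>carrier S. same_sigma S v w \<longrightarrow> same_sigma S (p v) (p w)) \<and>
    (\<forall>x\<in>carrier S. \<forall>y\<in>carrier S. \<forall>z\<in>carrier S.
      same_sigma S (p (sigma S x z)) (sigma S y (p z)))"

lemma compatible_closed: "compatible p \<Longrightarrow> x \<in> carrier S \<Longrightarrow> p x \<in> carrier S"
  by (auto simp: compatible_def)

lemma compatible_cong:
  "compatible p \<Longrightarrow> same_sigma S v w \<Longrightarrow> v \<in> carrier S \<Longrightarrow> w \<in> carrier S \<Longrightarrow>
    same_sigma S (p v) (p w)"
  by (simp add: compatible_def)

lemma compatible_commute:
  "compatible p \<Longrightarrow> x \<in> carrier S \<Longrightarrow> y \<in> carrier S \<Longrightarrow> z \<in> carrier S \<Longrightarrow>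
    same_sigma S (p (sigma S x z)) (sigma S y (p z))"
  by (simp add: compatible_def)

lemma compatible_sigma:
  assumes "compatible p" "a \<in> carrier S"
  shows "compatible (\<lambda>z. sigma S a (p z))"
  using assms by (auto simp: compatible_def Pi_iff same_sigma_sigma_sigma_iff)

text \<open>On classes f q = p, so f q f = p f = f p = f f q, and the injective f cancels.\<close>

lemma compatible_inv_sigma:
  assumes p: "compatible p" and a: "a \<in> carrier S" and q: "q \<in> carrier S \<rightarrow> carrier S"
    and pq: "\<And>z. z \<in> carrier S \<Longrightarrow> sigma S a (q z) = p z"
  shows "compatible q"
proof -
  have "same_sigma S (q v) (q w)"
    if "v \<in> carrier S" "w \<in> carrier S" "same_sigma S v w" for v w
    using compatible_cong[OF p that(3,1,2)] same_sigma_sigma_iff[of a "q v" "q w"] that a q pq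
    by (auto simp: Pi_iff)
  moreover have "same_sigma S (q (sigma S x z)) (sigma S y (q z))"
    if [simp]: "x \<in> carrier S" "y \<in> carrier S" "z \<in> carrier S" for x y z
  proof -
    have "same_sigma S (sigma S a (q (sigma S x z))) (sigma S a (sigma S y (q z)))
        \<longleftrightarrow> same_sigma S (p (sigma S x z)) (sigma S a (sigma S y (q z)))"
      using pq by simp
    moreover have "same_sigma S (p (sigma S x z)) (sigma S a (p z))"
      using compatible_commute[OF p] a by simp
    moreover have "same_sigma S (sigma S a (p z)) (sigma S a (sigma S y (q z)))"
    proof -
      have "same_sigma S (p z) (sigma S y (q z))"
        using pq[of z] sigma_retract[of a y "q z"] a q by (auto simp: Pi_iff)
      then show ?thesis
        using a q compatible_closed[OF p] by (auto simp: Pi_iff same_sigma_sigma_iff)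
    qed
    ultimately show ?thesis
      using a q same_sigma_sigma_iff[of a "q (sigma S x z)" "sigma S y (q z)"]
      by (auto simp: Pi_iff dest: same_sigma_trans)
  qed
  ultimately show ?thesis
    using q by (simp add: compatible_def)
qed

text \<open>The identity is compatible, and composing with some \<open>sigma S a\<close> or its
  inverse moves the value at \<open>x\<close> through the whole orbit.\<close>

lemma compatible_exists:
  assumes ind: "indecomposable S" and x: "x \<in> carrier S" and y: "y \<in> carrier S"
  shows "\<exists>p. compatible p \<and> p x = y"
  using ind x _ _ y
proof (rule indecomposable_induct)
  show "\<exists>p. compatible p \<and> p x = x"
    using sigma_retract by (intro exI[of _ id]) (auto simp: compatible_def)
next
  fix a z assume a: "a \<in> carrier S" and z: "z \<in> carrier S"
  show "(\<exists>p. compatible p \<and> p x = sigma S a z) \<longleftrightarrow> (\<exists>p. compatible p \<and> p x = z)"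
  proof
    assume "\<exists>p. compatible p \<and> p x = sigma S a z"
    then obtain p where p: "compatible p" "p x = sigma S a z" by blast
    define q where "q = (\<lambda>u. inv_into (carrier S) (sigma S a) (p u))"
    have q: "q u \<in> carrier S" "sigma S a (q u) = p u" if "u \<in> carrier S" for u
      using bij_sigma[OF a] compatible_closed[OF p(1) that]
      by (auto simp: q_def bij_betw_def inv_into_into f_inv_into_f)
    have "q x = z"
      using q[OF x] p(2) a z sigma_inj by metis
    moreover have "compatible q"
      using compatible_inv_sigma[OF p(1) a] q by auto
    ultimately show "\<exists>p. compatible p \<and> p x = z" by blast
  qed (use compatible_sigma a in fastforce)
qed

section \<open>Transitivity and freeness\<close>

text \<open>On classes the map is f, so an image determines the class of its argument
  \<open>z\<close>, hence the class of \<open>p z\<close> and the bijection that was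
  applied.\<close>

lemma diagonal_ybe_Aut:
  assumes p: "compatible p"
  shows "(\<lambda>z\<in>carrier S. sigma S (p z) z) \<in> carrier (ybe_Aut S)"
proof -
  note [simp] = compatible_closed[OF p]
  have "inj_on (\<lambda>z. sigma S (p z) z) (carrier S)"
  proof
    fix v w assume [simp]: "v \<in> carrier S" "w \<in> carrier S"
    assume eq: "sigma S (p v) v = sigma S (p w) w"
    then have "same_sigma S v w"
      using same_sigma_sigma_sigma_iff[of "p v" "p w" v w] by (simp add: same_sigma_refl)
    then have "sigma S (p v) v = sigma S (p v) w"
      using eq compatible_cong[OF p, of v w] by (simp add: same_sigmaD)
    then show "v = w"
      by (rule sigma_inj[rotated 3]) simp_all
  qed
  moreover have "\<exists>z\<in>carrier S. v = sigma S (p z) z" if v: "v \<in> carrier S" for v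
  proof -
    \<comment> \<open>\<open>u\<close> represents the preimage of the class of \<open>v\<close>
      under f. It fixes the class of \<open>p z\<close> before \<open>z\<close> itself is
      known.\<close>
    obtain u where u: "u \<in> carrier S" "sigma S v u = v"
      using sigma_surj v by blast
    obtain z where z: "z \<in> carrier S" "sigma S (p u) z = v"
      using sigma_surj[of "p u" v] u v by auto
    have "same_sigma S z u"
      using same_sigma_sigma_sigma_iff[of "p u" v z u] u v z by (simp add: same_sigma_refl)
    then have "sigma S (p z) z = v"
      using compatible_cong[OF p, of z u] u z by (simp add: same_sigmaD)
    then show ?thesis using z by blast
  qed
  ultimately have "bij_betw (\<lambda>z. sigma S (p z) z) (carrier S) (carrier S)"
    by (auto simp: bij_betw_def)
  moreover have "sigma S (p (sigma S x z)) (sigma S x z) =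
      sigma S (sigma S (p x) x) (sigma S (p z) z)"
    if [simp]: "x \<in> carrier S" "z \<in> carrier S" for x z
  proof -
    let ?s = "sigma S (p x) x"
    have "sigma S ?s (sigma S (p z) z) = sigma S (sigma S ?s (p z)) (sigma S (tau S ?s (p z)) z)"
      by (rule sigma_sigma) simp_all
    also have "\<dots> = sigma S (p (sigma S x z)) (sigma S (tau S ?s (p z)) z)"
      using compatible_commute[OF p, of x ?s z] by (simp add: same_sigmaD)
    \<comment> \<open>By involutivity f maps the class of \<open>tau S ?s (p z)\<close> to that of
      \<open>?s\<close>, as it does the class of \<open>x\<close>.\<close>
    also have "sigma S (tau S ?s (p z)) z = sigma S x z"
    proof -
      have "sigma S (sigma S ?s (p z)) (tau S ?s (p z)) = ?s"
        by (rule involutive_sigma) simp_all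
      then have "same_sigma S (tau S ?s (p z)) x"
        using same_sigma_sigma_sigma_iff[of "sigma S ?s (p z)" "p x" "tau S ?s (p z)" x]
        by (simp add: same_sigma_refl)
      then show ?thesis by (simp add: same_sigmaD)
    qed
    finally show ?thesis by simp
  qed
  ultimately show ?thesis
    by (auto simp: ybe_Aut_iff Bij_def)
qed

lemma ybe_Aut_sigma:
  assumes "indecomposable S" "a \<in> carrier S" "x \<in> carrier S"
  obtains \<Phi> where "\<Phi> \<in> carrier (ybe_Aut S)" "\<Phi> x = sigma S a x"
proof -
  obtain p where "compatible p" "p x = a"
    using compatible_exists assms by blast
  then show ?thesis
    using that[OF diagonal_ybe_Aut] assms by simp
qed

lemma transitive_action_ybe_Aut:
  assumes ind: "indecomposable S"
  shows "transitive_action (ybe_Aut S) (carrier S) (\<lambda>\<Phi>. \<Phi>)"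
proof -
  interpret group_action "ybe_Aut S" "carrier S" "\<lambda>\<Phi>. \<Phi>"
    by (rule group_action_ybe_Aut)
  have "y \<in> orbit (ybe_Aut S) (\<lambda>\<Phi>. \<Phi>) x" if x: "x \<in> carrier S" and y: "y \<in> carrier S" for x y
    using ind x _ _ y
  proof (rule indecomposable_induct)
    show "x \<in> orbit (ybe_Aut S) (\<lambda>\<Phi>. \<Phi>) x"
      using x by (rule orbit_refl)
  next
    fix a z assume az: "a \<in> carrier S" "z \<in> carrier S"
    then have "sigma S a z \<in> orbit (ybe_Aut S) (\<lambda>\<Phi>. \<Phi>) z"
      using ybe_Aut_sigma[OF ind] by (metis (mono_tags, lifting) orbit_def mem_Collect_eq)
    then show "sigma S a z \<in> orbit (ybe_Aut S) (\<lambda>\<Phi>. \<Phi>) x \<longleftrightarrow>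
        z \<in> orbit (ybe_Aut S) (\<lambda>\<Phi>. \<Phi>) x"
      using az x orbit_sym orbit_trans by (meson sigma_closed)
  qed
  then show ?thesis
    by unfold_locales (auto simp: orbit_def)
qed

lemma ybe_Aut_free:
  assumes ind: "indecomposable S" and \<Phi>: "\<Phi> \<in> carrier (ybe_Aut S)"
    and x: "x \<in> carrier S" "\<Phi> x = x" and y: "y \<in> carrier S"
  shows "\<Phi> y = y"
proof -
  have hom: "\<Phi> (sigma S a z) = sigma S (\<Phi> a) (\<Phi> z)"
    if "a \<in> carrier S" "z \<in> carrier S" for a z
    using \<Phi> that by (simp add: ybe_Aut_iff)
  note [simp] = ybe_Aut_closed[OF \<Phi>]
  \<comment> \<open>First induction, on classes: the classes fixed by \<Phi> are closed under f and
    its inverse.\<close>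
  have E: "same_sigma S (\<Phi> z) z" if "z \<in> carrier S" for z
    using ind x(1) _ _ that
    by (rule indecomposable_induct)
      (simp_all add: x same_sigma_refl hom same_sigma_sigma_sigma_iff)
  have comm: "\<Phi> (sigma S a z) = sigma S a (\<Phi> z)" if "a \<in> carrier S" "z \<in> carrier S" for a z
    using that hom same_sigmaD[OF E] by simp
  show ?thesis
    \<comment> \<open>Second induction, on points: \<Phi> now commutes with every
      \<open>sigma S a\<close>.\<close>
    using ind x _ y
  proof (rule indecomposable_induct)
    fix a z assume "a \<in> carrier S" "z \<in> carrier S"
    then show "\<Phi> (sigma S a z) = sigma S a z \<longleftrightarrow> \<Phi> z = z"
      using comm sigma_inj[of a "\<Phi> z" z] by auto
  qed
qed

end

theorem proposition5p18:
  fixes Y :: "'a ybe"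
  assumes "ybe_solution Y"
    and "indecomposable Y"
    and "multipermutation_level_2 Y"
  shows "regular_action (ybe_Aut Y) (carrier Y) (\<lambda>\<Phi>. \<Phi>)"
proof -
  interpret ybe_solution Y by fact
  interpret two_permutational Y
    using assms(3) two_permutationalI by (simp add: multipermutation_level_2_def)
  interpret transitive_action "ybe_Aut Y" "carrier Y" "\<lambda>\<Phi>. \<Phi>"
    by (rule transitive_action_ybe_Aut[OF assms(2)])
  show ?thesis
  proof
    fix x g assume *: "x \<in> carrier Y" "g \<in> carrier (ybe_Aut Y)" "g x = x"
    \<comment> \<open>The identity of \<open>BijGroup\<close> is the restricted identity, so values
      outside the carrier must agree too.\<close>
    have "g = (\<lambda>x\<in>carrier Y. x)"
    proof (rule extensionalityI)
      show "g \<in> extensional (carrier Y)"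
        using * by (simp add: ybe_Aut_iff Bij_imp_extensional)
      show "g y = (\<lambda>x\<in>carrier Y. x) y" if "y \<in> carrier Y" for y
        using ybe_Aut_free[OF assms(2) *(2,1,3) that] that by simp
    qed simp
    then show "g = \<one>\<^bsub>ybe_Aut Y\<^esub>"
      by (simp add: id_eq_one)
  qed
qed

end
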